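(* Every finitely generated free abelian quandle is subquandle separable.
   Context: A quandle is a set $X$ with a binary operation $*$ such that: (1) $x*x=x$ for all $x$; (2) for all $x,y \in X$ there is a unique $z\in X$ with $x=z*y$ (written $z=x*^{-1}y$); (3) $(x*y)*z=(x*z)*(y*z)$ for all $x,y,z$. A quandle $X$ is abelian if the group $\mathrm{Inn}(X)$ generated by the automorphisms $S_x:y\mapsto y*x$ ($x\in X$) is abelian; equivalently, $(x*y)*z=(x*z)*y$ for all $x,y,z\in X$. A finitely generated free abelian quandle is a free object on a finite set $\{x_1,\dots,x_r\}$ in the category of abelian quandles; it has the quandle presentation $\langle x_1,\dots,x_r \mid (x_i*x_j)*x_k=(x_i*x_k)*x_j \text{ for all } 1\le i,j,k\le r\rangle$. A subquandle is a subset closed under $*$ and $*^{-1}$; it is finitely generated if it is the smallest subquandle containing some finite set. A subset $S$ of a quandle $X$ is separable in $X$ if for each $x\in X\setminus S$ there exist a finite quandle $F$ and a quandle homomorphism $\phi:X\to F$ with $\phi(x)\notin\phi(S)$. A quandle is subquandle separable if each of its finitely generated subquandles is separable. *)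

theory Defs
  imports "HOL-Algebra.Bij" "HOL-Algebra.Generated_Groups" "HOL-Library.Countable_Set"
begin

section \<open>Quandles\<close>

record 'a quandle = "'a partial_object" +
  qop :: "'a \<Rightarrow> 'a \<Rightarrow> 'a" (infixl \<open>\<star>\<index>\<close> 70)

locale quandle =
  fixes X :: "'a quandle" (structure)
  assumes closed: "\<lbrakk>x \<in> carrier X; y \<in> carrier X\<rbrakk> \<Longrightarrow> x \<star> y \<in> carrier X"
    and idem: "x \<in> carrier X \<Longrightarrow> x \<star> x = x"
    and ex1_div: "\<lbrakk>x \<in> carrier X; y \<in> carrier X\<rbrakk> \<Longrightarrow> \<exists>!z. z \<in> carrier X \<and> x = z \<star> y"
    and distrib: "\<lbrakk>x \<in> carrier X; y \<in> carrier X; z \<in> carrier X\<rbrakk>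
        \<Longrightarrow> (x \<star> y) \<star> z = (x \<star> z) \<star> (y \<star> z)"

definition qinv :: "'a quandle \<Rightarrow> 'a \<Rightarrow> 'a \<Rightarrow> 'a" where
  "qinv X x y = (THE z. z \<in> carrier X \<and> x = z \<star>\<^bsub>X\<^esub> y)"

definition quandle_hom :: "'a quandle \<Rightarrow> 'b quandle \<Rightarrow> ('a \<Rightarrow> 'b) set" where
  "quandle_hom X Y = {h \<in> carrier X \<rightarrow> carrier Y.
     \<forall>x\<in>carrier X. \<forall>y\<in>carrier X. h (x \<star>\<^bsub>X\<^esub> y) = h x \<star>\<^bsub>Y\<^esub> h y}"

definition subquandle :: "'a set \<Rightarrow> 'a quandle \<Rightarrow> bool" where
  "subquandle T X \<longleftrightarrow> T \<subseteq> carrier X \<and>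
     (\<forall>x\<in>T. \<forall>y\<in>T. x \<star>\<^bsub>X\<^esub> y \<in> T \<and> qinv X x y \<in> T)"

definition fin_gen_subquandle :: "'a set \<Rightarrow> 'a quandle \<Rightarrow> bool" where
  "fin_gen_subquandle T X \<longleftrightarrow> subquandle T X \<and>
     (\<exists>A. finite A \<and> A \<subseteq> T \<and> (\<forall>T'. subquandle T' X \<and> A \<subseteq> T' \<longrightarrow> T \<subseteq> T'))"


section \<open>Abelian quandles\<close>

definition right_translation :: "'a quandle \<Rightarrow> 'a \<Rightarrow> 'a \<Rightarrow> 'a" where
  "right_translation X x = (\<lambda>y\<in>carrier X. y \<star>\<^bsub>X\<^esub> x)"

definition Inn :: "'a quandle \<Rightarrow> ('a \<Rightarrow> 'a) monoid" where
  "Inn X = subgroup_generated (BijGroup (carrier X)) (right_translation X ` carrier X)"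

definition abelian_quandle :: "'a quandle \<Rightarrow> bool" where
  "abelian_quandle X \<longleftrightarrow> quandle X \<and> comm_group (Inn X)"


lemma (in group) comm_group_subgroup_generated:
  assumes R: "R \<subseteq> carrier G" and comm: "\<And>a b. \<lbrakk>a \<in> R; b \<in> R\<rbrakk> \<Longrightarrow> a \<otimes> b = b \<otimes> a"
  shows "comm_group (subgroup_generated G R)"
proof -
  define C where "C K = {g \<in> carrier G. \<forall>k\<in>K. g \<otimes> k = k \<otimes> g}" for K
  have sub: "subgroup (C K) G" if K: "K \<subseteq> carrier G" for K
  proof (rule subgroupI)
    show "C K \<subseteq> carrier G" by (auto simp: C_def)
    show "C K \<noteq> {}" using K by (auto simp: C_def intro!: exI[of _ \<one>])
    show "inv a \<in> C K" if a: "a \<in> C K" for a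
    proof -
      have "inv a \<otimes> k = k \<otimes> inv a" if "k \<in> K" for k
      proof -
        have [simp]: "k \<in> carrier G" "a \<in> carrier G" and ak: "a \<otimes> k = k \<otimes> a"
          using a that K by (auto simp: C_def)
        have "inv a \<otimes> k = inv a \<otimes> (k \<otimes> a) \<otimes> inv a" by (simp add: m_assoc)
        also have "\<dots> = inv a \<otimes> (a \<otimes> k) \<otimes> inv a" using ak by simp
        also have "\<dots> = k \<otimes> inv a" by (simp add: m_assoc[symmetric])
        finally show ?thesis .
      qed
      then show ?thesis using a by (auto simp: C_def)
    qed
    show "a \<otimes> b \<in> C K" if a: "a \<in> C K" and b: "b \<in> C K" for a b
    proof -
      have "a \<otimes> b \<otimes> k = k \<otimes> (a \<otimes> b)" if "k \<in> K" for k
      proof -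
        have [simp]: "k \<in> carrier G" "a \<in> carrier G" "b \<in> carrier G"
          and k: "a \<otimes> k = k \<otimes> a" "b \<otimes> k = k \<otimes> b"
          using a b that K by (auto simp: C_def)
        have "a \<otimes> b \<otimes> k = a \<otimes> k \<otimes> b" by (simp add: m_assoc k(2))
        also have "\<dots> = k \<otimes> (a \<otimes> b)" by (simp add: m_assoc k(1))
        finally show ?thesis .
      qed
      then show ?thesis using a b by (auto simp: C_def)
    qed
  qed
  have "R \<subseteq> C R" using R comm by (auto simp: C_def)
  then have "generate G R \<subseteq> C R" by (rule generate_subgroup_incl[OF _ sub[OF R]])
  then have "R \<subseteq> C (generate G R)" using R by (fastforce simp: C_def)
  then have *: "generate G R \<subseteq> C (generate G R)"
    by (rule generate_subgroup_incl[OF _ sub[OF generate_incl[OF R]]])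
  show ?thesis
  proof (rule group.group_comm_groupI)
    show "Group.group (subgroup_generated G R)" by simp
    fix x y assume "x \<in> carrier (subgroup_generated G R)" "y \<in> carrier (subgroup_generated G R)"
    then show "x \<otimes>\<^bsub>subgroup_generated G R\<^esub> y = y \<otimes>\<^bsub>subgroup_generated G R\<^esub> x"
      using * R by (auto simp: subgroup_generated_def C_def Int_absorb1)
  qed
qed

lemma (in quandle) right_translation_Bij:
  assumes "x \<in> carrier X"
  shows "right_translation X x \<in> Bij (carrier X)"
proof -
  have "bij_betw (\<lambda>y. y \<star> x) (carrier X) (carrier X)"
    unfolding bij_betw_def inj_on_def
  proof (intro conjI ballI impI equalityI subsetI)
    fix a b assume "a \<in> carrier X" "b \<in> carrier X" "a \<star> x = b \<star> x"
    then show "a = b" using ex1_div[of "a \<star> x" x] closed assms by metis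
  next
    fix a assume "a \<in> (\<lambda>y. y \<star> x) ` carrier X"
    then show "a \<in> carrier X" using closed assms by auto
  next
    fix a assume "a \<in> carrier X"
    then show "a \<in> (\<lambda>y. y \<star> x) ` carrier X" using ex1_div[of a x] assms by blast
  qed
  then show ?thesis by (auto simp: Bij_def right_translation_def cong: bij_betw_cong)
qed

lemma abelian_quandle_iff:
  "abelian_quandle X \<longleftrightarrow> quandle X \<and>
     (\<forall>x\<in>carrier X. \<forall>y\<in>carrier X. \<forall>z\<in>carrier X.
        (x \<star>\<^bsub>X\<^esub> y) \<star>\<^bsub>X\<^esub> z = (x \<star>\<^bsub>X\<^esub> z) \<star>\<^bsub>X\<^esub> y)"
proof (cases "quandle X")
  case True
  interpret quandle X by fact
  let ?G = "BijGroup (carrier X)" and ?R = "right_translation X ` carrier X"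
  interpret G: group ?G by (rule group_BijGroup)
  have R: "?R \<subseteq> carrier ?G" using right_translation_Bij by (auto simp: BijGroup_def)
  have mult: "right_translation X y \<otimes>\<^bsub>?G\<^esub> right_translation X z
      = (\<lambda>x\<in>carrier X. (x \<star>\<^bsub>X\<^esub> z) \<star>\<^bsub>X\<^esub> y)"
    if "y \<in> carrier X" "z \<in> carrier X" for y z
    using that right_translation_Bij closed
    by (auto simp: BijGroup_def compose_def right_translation_def fun_eq_iff)
  show ?thesis
  proof
    assume "abelian_quandle X"
    then interpret I: comm_group "Inn X" by (simp add: abelian_quandle_def)
    have comm: "right_translation X y \<otimes>\<^bsub>?G\<^esub> right_translation X z
        = right_translation X z \<otimes>\<^bsub>?G\<^esub> right_translation X y"
      if "y \<in> carrier X" "z \<in> carrier X" for y z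
      using I.m_comm[of "right_translation X y" "right_translation X z"] that R
      by (auto simp: Inn_def subgroup_generated_def Int_absorb1 intro: generate.incl)
    have "(x \<star>\<^bsub>X\<^esub> z) \<star>\<^bsub>X\<^esub> y = (x \<star>\<^bsub>X\<^esub> y) \<star>\<^bsub>X\<^esub> z"
      if "x \<in> carrier X" "y \<in> carrier X" "z \<in> carrier X" for x y z
    proof -
      have "(\<lambda>x\<in>carrier X. (x \<star>\<^bsub>X\<^esub> z) \<star>\<^bsub>X\<^esub> y)
          = (\<lambda>x\<in>carrier X. (x \<star>\<^bsub>X\<^esub> y) \<star>\<^bsub>X\<^esub> z)"
        using comm[of y z] that by (simp only: mult)
      from fun_cong[OF this, of x] show ?thesis using that by simp
    qed
    then show "quandle X \<and> (\<forall>x\<in>carrier X. \<forall>y\<in>carrier X. \<forall>z\<in>carrier X.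
        (x \<star>\<^bsub>X\<^esub> y) \<star>\<^bsub>X\<^esub> z = (x \<star>\<^bsub>X\<^esub> z) \<star>\<^bsub>X\<^esub> y)"
      using True by blast
  next
    assume "quandle X \<and> (\<forall>x\<in>carrier X. \<forall>y\<in>carrier X. \<forall>z\<in>carrier X.
        (x \<star>\<^bsub>X\<^esub> y) \<star>\<^bsub>X\<^esub> z = (x \<star>\<^bsub>X\<^esub> z) \<star>\<^bsub>X\<^esub> y)"
    then show "abelian_quandle X"
      unfolding abelian_quandle_def Inn_def using R
      by (auto simp: mult intro!: G.comm_group_subgroup_generated restrict_ext)
  qed
qed (simp add: abelian_quandle_def)


section \<open>Free abelian quandles\<close>

text \<open>
  The universal property cannot quantify over target quandles of all types.  The type
  \<open>'a + nat\<close> contains copies of \<open>X\<close> itself and of every countable quandle, which is enough: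
  \<open>free_abelian_quandle_universal\<close> below derives the universal property with respect to
  abelian quandles of an arbitrary type.  Homomorphisms are taken to be extensional so that
  uniqueness refers to their values on the carrier only.
\<close>

definition free_abelian_quandle_on :: "'a quandle \<Rightarrow> 'a set \<Rightarrow> bool" where
  "free_abelian_quandle_on X S \<longleftrightarrow> abelian_quandle X \<and> S \<subseteq> carrier X \<and>
     (\<forall>Y :: ('a + nat) quandle. \<forall>f. abelian_quandle Y \<and> f \<in> S \<rightarrow> carrier Y \<longrightarrow>
        (\<exists>!h. h \<in> quandle_hom X Y \<and> h \<in> extensional (carrier X) \<and> (\<forall>s\<in>S. h s = f s)))"


lemma (in quandle) qinv_props:
  assumes "x \<in> carrier X" "y \<in> carrier X"
  shows "qinv X x y \<in> carrier X" "qinv X x y \<star> y = x"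
  using theI'[OF ex1_div[OF assms]] by (auto simp: qinv_def)

lemma (in quandle) qinv_eqI:
  assumes "x \<in> carrier X" "y \<in> carrier X" "z \<in> carrier X" "z \<star> y = x"
  shows "qinv X x y = z"
  using ex1_div[OF assms(1,2)] qinv_props[OF assms(1,2)] assms by metis

lemma quandle_hom_qinv:
  assumes "quandle X" "quandle Y" "h \<in> quandle_hom X Y" "x \<in> carrier X" "y \<in> carrier X"
  shows "h (qinv X x y) = qinv Y (h x) (h y)"
proof -
  interpret X: quandle X by fact
  interpret Y: quandle Y by fact
  have h: "h \<in> carrier X \<rightarrow> carrier Y"
    "\<And>a b. \<lbrakk>a \<in> carrier X; b \<in> carrier X\<rbrakk> \<Longrightarrow> h (a \<star>\<^bsub>X\<^esub> b) = h a \<star>\<^bsub>Y\<^esub> h b"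
    using assms(3) by (auto simp: quandle_hom_def)
  show ?thesis
    using h X.qinv_props[OF assms(4,5)] assms(4,5) by (metis PiE Y.qinv_eqI)
qed

text \<open>Transporting the structure of a subquandle \<open>T\<close> along an injection \<open>g\<close> into another type.\<close>

lemma abelian_quandle_image:
  assumes X: "abelian_quandle X" and T: "subquandle T X" and g: "inj_on g T"
  defines "Z \<equiv> \<lparr>carrier = g ` T,
     qop = \<lambda>a b. g (inv_into T g a \<star>\<^bsub>X\<^esub> inv_into T g b)\<rparr>"
  shows "abelian_quandle Z"
    and "\<And>x y. \<lbrakk>x \<in> T; y \<in> T\<rbrakk> \<Longrightarrow> g x \<star>\<^bsub>Z\<^esub> g y = g (x \<star>\<^bsub>X\<^esub> y)"
proof -
  interpret X: quandle X using X by (simp add: abelian_quandle_def)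
  have TX: "x \<in> carrier X" if "x \<in> T" for x using T that by (auto simp: subquandle_def)
  have cl: "x \<star>\<^bsub>X\<^esub> y \<in> T" "qinv X x y \<in> T" if "x \<in> T" "y \<in> T" for x y
    using T that by (auto simp: subquandle_def)
  have car: "carrier Z = g ` T" by (simp add: Z_def)
  show op: "g x \<star>\<^bsub>Z\<^esub> g y = g (x \<star>\<^bsub>X\<^esub> y)" if "x \<in> T" "y \<in> T" for x y
    using that g by (simp add: Z_def)
  have "quandle Z"
  proof
    fix x y assume "x \<in> carrier Z" "y \<in> carrier Z"
    then obtain a b where ab: "x = g a" "y = g b" "a \<in> T" "b \<in> T" by (auto simp: car)
    show "x \<star>\<^bsub>Z\<^esub> y \<in> carrier Z" using ab op cl by (auto simp: car)
    show "\<exists>!z. z \<in> carrier Z \<and> x = z \<star>\<^bsub>Z\<^esub> y"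
    proof (rule ex1I[of _ "g (qinv X a b)"])
      show "g (qinv X a b) \<in> carrier Z \<and> x = g (qinv X a b) \<star>\<^bsub>Z\<^esub> y"
        using ab op cl X.qinv_props TX by (auto simp: car)
      fix z assume "z \<in> carrier Z \<and> x = z \<star>\<^bsub>Z\<^esub> y"
      then obtain c where c: "z = g c" "c \<in> T" "g a = g (c \<star>\<^bsub>X\<^esub> b)" using ab op by (auto simp: car)
      then have "a = c \<star>\<^bsub>X\<^esub> b" using g ab cl by (auto simp: inj_on_def)
      then show "z = g (qinv X a b)" using X.qinv_eqI c ab TX by metis
    qed
  qed (auto simp: car op cl X.idem X.distrib[symmetric] TX)
  then show "abelian_quandle Z"
    using X unfolding abelian_quandle_iff by (auto simp: car op cl TX)
qed

inductive_set subquandle_hull :: "'a quandle \<Rightarrow> 'a set \<Rightarrow> 'a set" for X A where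
  base: "x \<in> A \<Longrightarrow> x \<in> subquandle_hull X A"
| op: "\<lbrakk>x \<in> subquandle_hull X A; y \<in> subquandle_hull X A\<rbrakk> \<Longrightarrow> x \<star>\<^bsub>X\<^esub> y \<in> subquandle_hull X A"
| qinv: "\<lbrakk>x \<in> subquandle_hull X A; y \<in> subquandle_hull X A\<rbrakk> \<Longrightarrow> qinv X x y \<in> subquandle_hull X A"

lemma subquandle_subquandle_hull:
  assumes "quandle X" "A \<subseteq> carrier X"
  shows "subquandle (subquandle_hull X A) X"
proof -
  interpret quandle X by fact
  have "x \<in> carrier X" if "x \<in> subquandle_hull X A" for x
    using that by induction (use assms closed qinv_props in auto)
  then show ?thesis by (auto simp: subquandle_def intro: subquandle_hull.intros)
qed

lemma countable_subquandle_hull: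
  assumes "countable A"
  shows "countable (subquandle_hull X A)"
proof -
  define U where "U = rec_nat A (\<lambda>_ V. V \<union> (\<lambda>(x, y). x \<star>\<^bsub>X\<^esub> y) ` (V \<times> V) \<union> (\<lambda>(x, y). qinv X x y) ` (V \<times> V))"
  have U: "U 0 = A"
    "U (Suc n) = U n \<union> (\<lambda>(x, y). x \<star>\<^bsub>X\<^esub> y) ` (U n \<times> U n) \<union> (\<lambda>(x, y). qinv X x y) ` (U n \<times> U n)" for n
    by (simp_all add: U_def)
  have "countable (U n)" for n
    by (induction n) (use assms in \<open>auto simp: U\<close>)
  moreover have "mono U" unfolding mono_iff_le_Suc by (auto simp: U)
  then have mon: "U m \<subseteq> U n" if "m \<le> n" for m n using that by (simp add: monoD)
  have "\<exists>n. x \<in> U n" if "x \<in> subquandle_hull X A" for x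
    using that
  proof induction
    case (base x)
    then show ?case using U(1) by blast
  next
    case (op x y)
    then obtain m n where "x \<in> U m" "y \<in> U n" by blast
    then have "x \<in> U (max m n)" "y \<in> U (max m n)" using mon by (meson max.cobounded1 max.cobounded2 subsetD)+
    then have "x \<star>\<^bsub>X\<^esub> y \<in> U (Suc (max m n))" by (auto simp: U)
    then show ?case by blast
  next
    case (qinv x y)
    then obtain m n where "x \<in> U m" "y \<in> U n" by blast
    then have "x \<in> U (max m n)" "y \<in> U (max m n)" using mon by (meson max.cobounded1 max.cobounded2 subsetD)+
    then have "qinv X x y \<in> U (Suc (max m n))" by (auto simp: U)
    then show ?case by blast
  qed
  then have "subquandle_hull X A \<subseteq> (\<Union>n. U n)" by blast
  ultimately show ?thesis by (meson countable_UN countable_subset uncountable_def countableI_type)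
qed

lemma free_abelian_quandle_generated:
  assumes free: "free_abelian_quandle_on X S"
  shows "subquandle_hull X S = carrier X"
proof -
  let ?T = "subquandle_hull X S"
  let ?E = "\<lambda>T. \<lparr>carrier = Inl ` T,
     qop = \<lambda>a b. Inl (inv_into T Inl a \<star>\<^bsub>X\<^esub> inv_into T Inl b)\<rparr> :: ('a + nat) quandle"
  have X: "abelian_quandle X" "quandle X" and S: "S \<subseteq> carrier X"
    using free by (auto simp: free_abelian_quandle_on_def abelian_quandle_def)
  interpret quandle X by fact
  have T: "subquandle ?T X" by (rule subquandle_subquandle_hull) fact+
  then have TX: "?T \<subseteq> carrier X" by (simp add: subquandle_def)
  have C: "subquandle (carrier X) X" using closed qinv_props by (auto simp: subquandle_def)
  have inj: "inj_on Inl A" for A :: "'a set" by simp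
  note ZT = abelian_quandle_image[OF X(1) T inj] and ZC = abelian_quandle_image[OF X(1) C inj]
  have ex1: "\<exists>!h. h \<in> quandle_hom X Y \<and> h \<in> extensional (carrier X) \<and> (\<forall>s\<in>S. h s = f s)"
    if "abelian_quandle Y" "f \<in> S \<rightarrow> carrier Y" for f and Y :: "('a + nat) quandle"
    using free that unfolding free_abelian_quandle_on_def by blast
  have "Inl \<in> S \<rightarrow> carrier (?E ?T)" by (auto intro: subquandle_hull.base)
  from ex1[OF ZT(1) this] obtain h where
    h: "h \<in> quandle_hom X (?E ?T)" "h \<in> extensional (carrier X)" "\<forall>s\<in>S. h s = Inl s" by blast
  have hT: "h x \<in> Inl ` ?T" if "x \<in> carrier X" for x
    using h(1) that by (auto simp: quandle_hom_def)
  have hop: "h (x \<star>\<^bsub>X\<^esub> y) = h x \<star>\<^bsub>?E (carrier X)\<^esub> h y" if xy: "x \<in> carrier X" "y \<in> carrier X" for x y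
  proof -
    obtain a b where ab: "h x = Inl a" "h y = Inl b" "a \<in> ?T" "b \<in> ?T" using hT xy by blast
    have "h (x \<star>\<^bsub>X\<^esub> y) = h x \<star>\<^bsub>?E ?T\<^esub> h y" using h(1) xy by (auto simp: quandle_hom_def)
    also have "\<dots> = Inl (a \<star>\<^bsub>X\<^esub> b)" using ZT(2)[of a b] ab by simp
    also have "\<dots> = h x \<star>\<^bsub>?E (carrier X)\<^esub> h y" using ZC(2)[of a b] ab TX by (simp add: subset_iff)
    finally show ?thesis .
  qed
  have "h x \<in> Inl ` carrier X" if "x \<in> carrier X" for x using hT[OF that] TX by blast
  then have h': "h \<in> quandle_hom X (?E (carrier X))" using hop by (auto simp: quandle_hom_def)
  let ?i = "\<lambda>x\<in>carrier X. Inl x :: 'a + nat"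
  have i: "?i \<in> quandle_hom X (?E (carrier X))" "?i \<in> extensional (carrier X)" "\<forall>s\<in>S. ?i s = Inl s"
    using ZC(2) closed S by (auto simp: quandle_hom_def)
  have "Inl \<in> S \<rightarrow> carrier (?E (carrier X))" using S by auto
  from ex1[OF ZC(1) this] h' h(2,3) i have eq: "h = ?i" by blast
  show ?thesis
  proof
    show "?T \<subseteq> carrier X" by (rule TX)
    show "carrier X \<subseteq> ?T"
    proof
      fix x assume "x \<in> carrier X"
      then show "x \<in> ?T" using hT[of x] by (auto simp: eq)
    qed
  qed
qed

lemma free_abelian_quandle_universal:
  fixes X :: "'a quandle" and Y :: "'c quandle"
  assumes free: "free_abelian_quandle_on X S" and S: "countable S"
    and Y: "abelian_quandle Y" and f: "f \<in> S \<rightarrow> carrier Y"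
  shows "\<exists>!h. h \<in> quandle_hom X Y \<and> h \<in> extensional (carrier X) \<and> (\<forall>s\<in>S. h s = f s)"
proof -
  have XQ: "quandle X" "S \<subseteq> carrier X" and YQ: "quandle Y"
    using free Y by (auto simp: free_abelian_quandle_on_def abelian_quandle_def)
  interpret X: quandle X by fact
  interpret Y: quandle Y by fact
  let ?T = "subquandle_hull Y (f ` S)"
  have fS: "f ` S \<subseteq> carrier Y" using f by auto
  have T: "subquandle ?T Y" by (rule subquandle_subquandle_hull) fact+
  then have TY: "?T \<subseteq> carrier Y" by (simp add: subquandle_def)
  have cT: "countable ?T" using S by (intro countable_subquandle_hull) simp
  define g :: "'c \<Rightarrow> 'a + nat" where "g = Inr \<circ> to_nat_on ?T"
  have g: "inj_on g ?T" using cT by (auto simp: g_def inj_on_def)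
  define Z where "Z = \<lparr>carrier = g ` ?T,
     qop = \<lambda>a b. g (inv_into ?T g a \<star>\<^bsub>Y\<^esub> inv_into ?T g b)\<rparr>"
  have Z: "abelian_quandle Z" "\<And>x y. \<lbrakk>x \<in> ?T; y \<in> ?T\<rbrakk> \<Longrightarrow> g x \<star>\<^bsub>Z\<^esub> g y = g (x \<star>\<^bsub>Y\<^esub> y)"
    "carrier Z = g ` ?T"
    using abelian_quandle_image[OF Y T g] by (simp_all add: Z_def)
  have "g \<circ> f \<in> S \<rightarrow> carrier Z" by (auto simp: Z intro!: imageI subquandle_hull.base)
  then obtain k where k: "k \<in> quandle_hom X Z" "\<forall>s\<in>S. k s = g (f s)"
    using free Z(1) unfolding free_abelian_quandle_on_def by (metis comp_apply)
  define h0 where "h0 = (\<lambda>x\<in>carrier X. inv_into ?T g (k x))"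
  have kT: "k x \<in> g ` ?T" if "x \<in> carrier X" for x
    using k(1) that Z(3) by (auto simp: quandle_hom_def)
  have hT: "h0 x \<in> ?T" "g (h0 x) = k x" if "x \<in> carrier X" for x
    using kT[OF that] that by (auto simp: h0_def inv_into_into f_inv_into_f)
  show ?thesis
  proof (rule ex_ex1I)
    have "h0 (x \<star>\<^bsub>X\<^esub> y) = h0 x \<star>\<^bsub>Y\<^esub> h0 y" if xy: "x \<in> carrier X" "y \<in> carrier X" for x y
    proof -
      have "g (h0 (x \<star>\<^bsub>X\<^esub> y)) = k x \<star>\<^bsub>Z\<^esub> k y"
        using hT(2)[OF X.closed[OF xy]] k(1) xy by (auto simp: quandle_hom_def)
      also have "\<dots> = g (h0 x \<star>\<^bsub>Y\<^esub> h0 y)"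
        using Z(2)[OF hT(1)[OF xy(1)] hT(1)[OF xy(2)]] hT(2)[OF xy(1)] hT(2)[OF xy(2)] by metis
      finally show ?thesis
        using g hT(1)[OF X.closed[OF xy]] subquandle_hull.op[OF hT(1)[OF xy(1)] hT(1)[OF xy(2)]]
        by (metis inj_onD)
    qed
    moreover have "h0 \<in> carrier X \<rightarrow> carrier Y" using hT(1) TY by (meson Pi_I subsetD)
    moreover have "h0 s = f s" if "s \<in> S" for s
      using that k(2) XQ(2) g by (auto simp: h0_def intro!: inv_into_f_f subquandle_hull.base)
    moreover have "h0 \<in> extensional (carrier X)" by (simp add: h0_def)
    ultimately show "\<exists>h. h \<in> quandle_hom X Y \<and> h \<in> extensional (carrier X) \<and> (\<forall>s\<in>S. h s = f s)"
      unfolding quandle_hom_def by (intro exI[of _ h0]) simp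
  next
    fix h h'
    assume h: "h \<in> quandle_hom X Y \<and> h \<in> extensional (carrier X) \<and> (\<forall>s\<in>S. h s = f s)"
      and h': "h' \<in> quandle_hom X Y \<and> h' \<in> extensional (carrier X) \<and> (\<forall>s\<in>S. h' s = f s)"
    have car: "carrier X = subquandle_hull X S"
      using free_abelian_quandle_generated[OF free] by simp
    have "h x = h' x" if "x \<in> subquandle_hull X S" for x
      using that
    proof induction
      case (base x)
      then show ?case using h h' by simp
    next
      case (op x y)
      then show ?case using h h' by (simp add: quandle_hom_def car)
    next
      case (qinv x y)
      then have "h (qinv X x y) = qinv Y (h x) (h y)" "h' (qinv X x y) = qinv Y (h' x) (h' y)"
        using quandle_hom_qinv[OF XQ(1) YQ, of h x y] quandle_hom_qinv[OF XQ(1) YQ, of h' x y] h h'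
        by (simp_all add: car)
      then show ?case using qinv.IH by simp
    qed
    then show "h = h'" using h h' car by (metis extensionalityI)
  qed
qed


section \<open>Separability\<close>

text \<open>Every finite quandle is isomorphic to one whose elements are natural numbers.\<close>

definition separable_in :: "'a set \<Rightarrow> 'a quandle \<Rightarrow> bool" where
  "separable_in S X \<longleftrightarrow> (\<forall>x \<in> carrier X - S. \<exists>(F :: nat quandle) \<phi>.
     quandle F \<and> finite (carrier F) \<and> \<phi> \<in> quandle_hom X F \<and> \<phi> x \<notin> \<phi> ` S)"

definition subquandle_separable :: "'a quandle \<Rightarrow> bool" where
  "subquandle_separable X \<longleftrightarrow> quandle X \<and> (\<forall>T. fin_gen_subquandle T X \<longrightarrow> separable_in T X)"

end

theory Submission
  imports Defs "HOL-Algebra.FiniteProduct"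
begin

text \<open>
  In an abelian quandle \<open>x \<star> (y \<star> z) = x \<star> y\<close>, so an element acts from the right only through
  its orbit.  In a free one on \<open>S\<close> every element is therefore reached from a unique generator
  \<open>i\<close> by applying each translation by a generator \<open>k\<close> an integer number \<open>v k\<close> of times, in any
  order; as \<open>i \<star> i = i\<close>, the exponent of \<open>i\<close> itself is irrelevant and is normalised to \<open>0\<close>.
  Thus the free abelian quandle is the disjoint union over \<open>i \<in> S\<close> of copies of the integer
  vectors modulo the \<open>i\<close>-th unit vector \<open>e\<^sub>i\<close>, with \<open>(i, v) \<star> (j, w) = (i, v + e\<^sub>j)\<close>.  Freeness
  gives a homomorphism \<open>h\<close> to this model, and letting vectors act on generators gives a
  homomorphism back (\<open>translate_hom\<close>) that is a left inverse of \<open>h\<close>; so \<open>h\<close> is injective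
  (\<open>free_abelian_quandle_coordinates\<close>).

  In the model a subquandle generated by a finite set \<open>A\<close> is explicit.  If \<open>J\<close> is the set of
  indices occurring in \<open>A\<close>, it consists of the \<open>(i, w)\<close> for which some \<open>(i, a) \<in> A\<close> has the same
  coordinates as \<open>w\<close> outside \<open>J\<close>: nothing else can be reached (\<open>subquandle_coord_hull\<close>), and all
  of these are reached, since the coordinates in \<open>J\<close> can be changed one unit at a time
  (\<open>subquandle_coord_fill\<close>).  A point \<open>(i, v)\<close> outside it differs from each of the finitely many
  \<open>(i, a) \<in> A\<close> in a coordinate outside \<open>J\<close>.  Reduction of the coordinates modulo an integer that
  exceeds all these differences maps to a finite quandle and keeps the point apart from the
  subquandle.
\<close>


section \<open>Coordinate quandles\<close>

text \<open>
  If \<open>v\<close> has coordinates reduced modulo \<open>m\<close> and \<open>v i = 0\<close>, this is the representative of the same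
  form of \<open>v + d e\<^sub>j\<close> modulo \<open>m\<close> and \<open>e\<^sub>i\<close>.
\<close>

definition bump :: "int \<Rightarrow> 'a \<Rightarrow> 'a \<Rightarrow> int \<Rightarrow> ('a \<Rightarrow> int) \<Rightarrow> 'a \<Rightarrow> int" where
  "bump m i j d v = (if i = j then v else v(j := (v j + d) mod m))"

text \<open>
  Since \<open>k mod 0 = k\<close>, modulus \<open>0\<close> gives the integer model of the free abelian quandle, and a
  positive modulus gives its finite quotients.
\<close>

definition coord_quandle :: "'a set \<Rightarrow> int \<Rightarrow> ('a \<times> ('a \<Rightarrow> int)) quandle" where
  "coord_quandle S m = \<lparr>carrier = {(i, v). i \<in> S \<and> v i = 0 \<and> (\<forall>k. k \<notin> S \<longrightarrow> v k = 0) \<and> (\<forall>k. v k mod m = v k)},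
     qop = \<lambda>(i, v) (j, w). (i, bump m i j 1 v)\<rparr>"

lemma coord_carrier:
  "(i, v) \<in> carrier (coord_quandle S m) \<longleftrightarrow>
     i \<in> S \<and> v i = 0 \<and> (\<forall>k. k \<notin> S \<longrightarrow> v k = 0) \<and> (\<forall>k. v k mod m = v k)"
  by (simp add: coord_quandle_def)

lemma coord_op: "(i, v) \<star>\<^bsub>coord_quandle S m\<^esub> (j, w) = (i, bump m i j 1 v)"
  by (simp add: coord_quandle_def)

lemma bump_carrier:
  assumes "(i, v) \<in> carrier (coord_quandle S m)" "j \<in> S"
  shows "(i, bump m i j d v) \<in> carrier (coord_quandle S m)"
  using assms by (auto simp: coord_carrier bump_def)

lemma bump_bump_cancel:
  assumes "(i, v) \<in> carrier (coord_quandle S m)"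
  shows "bump m i j 1 (bump m i j (-1) v) = v" "bump m i j (-1) (bump m i j 1 v) = v"
  using assms by (auto simp: coord_carrier bump_def mod_simps fun_eq_iff)

lemma bump_commute: "bump m i j d (bump m i k e v) = bump m i k e (bump m i j d v)"
  by (auto simp: bump_def fun_eq_iff mod_simps algebra_simps)

lemma abelian_coord_quandle: "abelian_quandle (coord_quandle S m)"
proof -
  let ?Q = "coord_quandle S m"
  have "quandle ?Q"
  proof
    fix x y assume xy: "x \<in> carrier ?Q" "y \<in> carrier ?Q"
    obtain i v j w where [simp]: "x = (i, v)" "y = (j, w)" by fastforce
    have j: "j \<in> S" using xy by (simp add: coord_carrier)
    show "x \<star>\<^bsub>?Q\<^esub> y \<in> carrier ?Q"
      using xy bump_carrier[OF _ j] by (simp add: coord_op)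
    show "\<exists>!z. z \<in> carrier ?Q \<and> x = z \<star>\<^bsub>?Q\<^esub> y"
    proof (rule ex1I[of _ "(i, bump m i j (-1) v)"])
      show "(i, bump m i j (-1) v) \<in> carrier ?Q \<and> x = (i, bump m i j (-1) v) \<star>\<^bsub>?Q\<^esub> y"
        using xy bump_carrier[OF _ j] bump_bump_cancel(1)[of i v S m j] by (simp add: coord_op)
      show "z = (i, bump m i j (-1) v)" if "z \<in> carrier ?Q \<and> x = z \<star>\<^bsub>?Q\<^esub> y" for z
        using that bump_bump_cancel(2)[of i _ S m j] by (cases z) (auto simp: coord_op)
    qed
  next
    fix x assume "x \<in> carrier ?Q"
    then show "x \<star>\<^bsub>?Q\<^esub> x = x" by (cases x) (simp add: coord_op bump_def)
  next
    fix x y z assume "x \<in> carrier ?Q" "y \<in> carrier ?Q" "z \<in> carrier ?Q"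
    then show "x \<star>\<^bsub>?Q\<^esub> y \<star>\<^bsub>?Q\<^esub> z = x \<star>\<^bsub>?Q\<^esub> z \<star>\<^bsub>?Q\<^esub> (y \<star>\<^bsub>?Q\<^esub> z)"
      by (cases x; cases y; cases z) (simp add: coord_op bump_commute)
  qed
  then show ?thesis
    unfolding abelian_quandle_iff by (auto simp: coord_op bump_commute)
qed

lemma quandle_coord_quandle: "quandle (coord_quandle S m)"
  using abelian_coord_quandle[of S m] by (simp add: abelian_quandle_def)

lemma coord_qinv:
  assumes "(i, v) \<in> carrier (coord_quandle S m)" "(j, w) \<in> carrier (coord_quandle S m)"
  shows "qinv (coord_quandle S m) (i, v) (j, w) = (i, bump m i j (-1) v)"
proof (rule quandle.qinv_eqI[OF quandle_coord_quandle assms])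
  show "(i, bump m i j (-1) v) \<in> carrier (coord_quandle S m)"
    using assms by (intro bump_carrier) (auto simp: coord_carrier)
  show "(i, bump m i j (-1) v) \<star>\<^bsub>coord_quandle S m\<^esub> (j, w) = (i, v)"
    using bump_bump_cancel[OF assms(1)] by (simp add: coord_op)
qed

lemma finite_coord_quandle:
  assumes "finite S" "m > 0"
  shows "finite (carrier (coord_quandle S m))"
proof (rule finite_subset)
  let ?V = "{v. \<forall>k. (k \<in> S \<longrightarrow> v k \<in> {0..<m}) \<and> (k \<notin> S \<longrightarrow> v k = 0)}"
  show "finite (S \<times> ?V)"
    using assms by (intro finite_cartesian_product finite_set_of_finite_funs) auto
  show "carrier (coord_quandle S m) \<subseteq> S \<times> ?V"
  proof
    fix x assume x: "x \<in> carrier (coord_quandle S m)"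
    obtain i v where [simp]: "x = (i, v)" by fastforce
    have "v k \<in> {0..<m}" for k
      using x assms(2) pos_mod_bound[of m "v k"] pos_mod_sign[of m "v k"] by (auto simp: coord_carrier)
    then show "x \<in> S \<times> ?V" using x by (auto simp: coord_carrier)
  qed
qed

lemma reduction_hom:
  "(\<lambda>(i, v). (i, \<lambda>k. v k mod m)) \<in> quandle_hom (coord_quandle S 0) (coord_quandle S m)"
  by (auto simp: quandle_hom_def coord_carrier coord_op bump_def fun_eq_iff mod_simps)


section \<open>Subquandles of the integral coordinate quandle\<close>

lemma subquandle_coord_update:
  assumes B: "subquandle B (coord_quandle S 0)"
    and iv: "(i, v) \<in> B" and j: "j \<in> fst ` B" "j \<noteq> i"
  shows "(i, v(j := n)) \<in> B"
proof -
  have sub: "B \<subseteq> carrier (coord_quandle S 0)" using B by (simp add: subquandle_def)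
  obtain w where jw: "(j, w) \<in> B" using j(1) by auto
  have step: "(i, bump 0 i j 1 u) \<in> B \<and> (i, bump 0 i j (-1) u) \<in> B" if u: "(i, u) \<in> B" for u
    using B u jw coord_qinv[of i u S 0 j w] sub by (force simp: subquandle_def coord_op)
  show ?thesis
  proof (induction n rule: int_induct[of _ "v j"])
    case base
    then show ?case using iv by simp
  next
    case (step1 n)
    then show ?case using step[of "v(j := n)"] j(2) by (simp add: bump_def fun_upd_def cong: if_cong)
  next
    case (step2 n)
    then show ?case using step[of "v(j := n)"] j(2) by (simp add: bump_def fun_upd_def cong: if_cong)
  qed
qed

text \<open>
  A point of index \<open>j\<close> in the subquandle lets the \<open>j\<close>-th coordinate of every other point go up
  and down freely; treating the members of the finite set \<open>J\<close> one by one turns \<open>a\<close> into \<open>v\<close>.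
\<close>

lemma subquandle_coord_fill:
  assumes B: "subquandle B (coord_quandle S 0)"
    and iv: "(i, a) \<in> B" and J: "finite J" "J \<subseteq> fst ` B"
    and v: "v i = a i" "\<And>k. k \<notin> J \<Longrightarrow> v k = a k"
  shows "(i, v) \<in> B"
  using J v
proof (induction J arbitrary: v rule: finite_induct)
  case empty
  then have "v = a" by auto
  then show ?case using iv by simp
next
  case (insert j J)
  have "(i, v(j := a j)) \<in> B"
    using insert.prems by (intro insert.IH) auto
  show ?case
  proof (cases "j = i")
    case True
    then show ?thesis using \<open>(i, v(j := a j)) \<in> B\<close> insert.prems(2) by (simp add: fun_upd_idem)
  next
    case False
    then have "(i, (v(j := a j))(j := v j)) \<in> B"
      using insert.prems(1) by (intro subquandle_coord_update[OF B \<open>(i, v(j := a j)) \<in> B\<close>]) auto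
    then show ?thesis by simp
  qed
qed

text \<open>
  An operation by a point changes only the coordinate given by its index, and no operation
  creates a new index.  So the points that agree with a member of \<open>A\<close> away from the indices
  of \<open>A\<close> form a subquandle, an upper bound for the one generated by \<open>A\<close>.
\<close>

lemma subquandle_coord_hull:
  assumes A: "A \<subseteq> carrier (coord_quandle S 0)"
  shows "subquandle {(i, w). (i, w) \<in> carrier (coord_quandle S 0) \<and>
           (\<exists>a. (i, a) \<in> A \<and> (\<forall>k. k \<notin> fst ` A \<longrightarrow> w k = a k))} (coord_quandle S 0)"
    (is "subquandle ?C ?Q")
proof -
  have cl: "x \<star>\<^bsub>?Q\<^esub> y \<in> ?C \<and> qinv ?Q x y \<in> ?C" if xy: "x \<in> ?C" "y \<in> ?C" for x y
  proof -
    obtain i v j w where [simp]: "x = (i, v)" "y = (j, w)" by fastforce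
    obtain a where a: "(i, a) \<in> A" "\<forall>k. k \<notin> fst ` A \<longrightarrow> v k = a k" using xy by auto
    have j: "j \<in> fst ` A" using xy by force
    have c: "x \<in> carrier ?Q" "y \<in> carrier ?Q" using xy by auto
    then have "j \<in> S" by (simp add: coord_carrier)
    have "(i, bump 0 i j d v) \<in> ?C" for d
    proof -
      have "(i, bump 0 i j d v) \<in> carrier ?Q"
        using c \<open>j \<in> S\<close> by (intro bump_carrier) auto
      moreover have "bump 0 i j d v k = a k" if "k \<notin> fst ` A" for k
        using a(2) that j by (auto simp: bump_def)
      ultimately show ?thesis using a(1) by blast
    qed
    then show ?thesis using c coord_qinv[of i v S 0 j w] by (simp add: coord_op)
  qed
  show ?thesis unfolding subquandle_def
  proof (intro conjI ballI)
    show "?C \<subseteq> carrier ?Q" by auto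
  qed (erule (1) cl[THEN conjunct1], erule (1) cl[THEN conjunct2])
qed


section \<open>Coordinates in an abelian quandle\<close>

lemma right_translation_in_Inn:
  assumes "quandle X" "x \<in> carrier X"
  shows "right_translation X x \<in> carrier (Inn X)"
proof -
  have "right_translation X ` carrier X \<subseteq> carrier (BijGroup (carrier X))"
    using quandle.right_translation_Bij[OF assms(1)] by (auto simp: BijGroup_def)
  then show ?thesis
    using assms(2) by (auto simp: Inn_def subgroup_generated_def Int_absorb1 intro: generate.incl)
qed

lemma Inn_subset_Bij: "carrier (Inn X) \<subseteq> Bij (carrier X)"
  using group.carrier_subgroup_generated_subset[OF group_BijGroup] 
  by (fastforce simp: Inn_def BijGroup_def)

lemma Inn_apply_closed:
  assumes "f \<in> carrier (Inn X)" "x \<in> carrier X"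
  shows "f x \<in> carrier X"
  using assms Inn_subset_Bij Bij_imp_funcset by fastforce

lemma Inn_mult_apply:
  assumes "f \<in> carrier (Inn X)" "g \<in> carrier (Inn X)" "x \<in> carrier X"
  shows "(f \<otimes>\<^bsub>Inn X\<^esub> g) x = f (g x)"
  using assms Inn_subset_Bij[of X]
  by (auto simp: Inn_def BijGroup_def subgroup_generated_def compose_def restrict_def subset_iff)

lemma Inn_one_apply: "x \<in> carrier X \<Longrightarrow> \<one>\<^bsub>Inn X\<^esub> x = x"
  by (auto simp: Inn_def BijGroup_def subgroup_generated_def)

text \<open>
  Write \<open>x = u \<star> z\<close>: then \<open>x \<star> (y \<star> z) = (u \<star> y) \<star> z\<close> by distributivity, and the two right
  translations can be exchanged.
\<close>

lemma abelian_quandle_op_right_op: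
  assumes X: "abelian_quandle X" and c: "x \<in> carrier X" "y \<in> carrier X" "z \<in> carrier X"
  shows "x \<star>\<^bsub>X\<^esub> (y \<star>\<^bsub>X\<^esub> z) = x \<star>\<^bsub>X\<^esub> y"
proof -
  interpret quandle X using X by (simp add: abelian_quandle_def)
  obtain u where u: "u \<in> carrier X" "x = u \<star>\<^bsub>X\<^esub> z" using ex1_div[OF c(1,3)] by blast
  then show ?thesis
    using distrib[OF u(1) c(2,3)] X c unfolding abelian_quandle_iff by metis
qed

text \<open>
  The preceding lemma is the case of a generator \<open>f\<close> of the inner automorphism group; the property
  passes to products and inverses.
\<close>

lemma abelian_quandle_op_Inn:
  assumes X: "abelian_quandle X" and f: "f \<in> carrier (Inn X)"
    and c: "x \<in> carrier X" "y \<in> carrier X"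
  shows "x \<star>\<^bsub>X\<^esub> f y = x \<star>\<^bsub>X\<^esub> y"
proof -
  interpret quandle X using X by (simp add: abelian_quandle_def)
  let ?G = "BijGroup (carrier X)" and ?R = "right_translation X ` carrier X"
  interpret G: group ?G by (rule group_BijGroup)
  have R: "?R \<subseteq> carrier ?G" using right_translation_Bij by (auto simp: BijGroup_def)
  have cl: "h u \<in> carrier X" if "h \<in> carrier ?G" "u \<in> carrier X" for h u
    using that Bij_imp_funcset by (fastforce simp: BijGroup_def)
  have mult: "(h \<otimes>\<^bsub>?G\<^esub> k) u = h (k u)" if "h \<in> carrier ?G" "k \<in> carrier ?G" "u \<in> carrier X" for h k u
    using that by (auto simp: BijGroup_def compose_def)
  have unit: "\<one>\<^bsub>?G\<^esub> u = u" if "u \<in> carrier X" for u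
    using that by (simp add: BijGroup_def)
  have "f \<in> generate ?G ?R"
    using f R by (simp add: Inn_def subgroup_generated_def Int_absorb1)
  then have "\<forall>y\<in>carrier X. x \<star>\<^bsub>X\<^esub> f y = x \<star>\<^bsub>X\<^esub> y"
  proof induction
    case one
    then show ?case by (simp add: unit)
  next
    case (incl h)
    then show ?case
      using abelian_quandle_op_right_op[OF X c(1)] by (auto simp: right_translation_def)
  next
    case (inv h)
    then have h: "h \<in> carrier ?G" using R by blast
    obtain z where z: "z \<in> carrier X" "h = right_translation X z" using inv by blast
    show ?case
    proof
      fix u assume u: "u \<in> carrier X"
      let ?w = "(inv\<^bsub>?G\<^esub> h) u"
      have w: "?w \<in> carrier X" using cl[OF G.inv_closed[OF h] u] .
      have "h ?w = u" using mult[OF h G.inv_closed[OF h] u] unit[OF u] h by simp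
      then have "?w \<star>\<^bsub>X\<^esub> z = u" using w z by (simp add: right_translation_def)
      then show "x \<star>\<^bsub>X\<^esub> ?w = x \<star>\<^bsub>X\<^esub> u"
        using abelian_quandle_op_right_op[OF X c(1) w z(1)] by simp
    qed
  next
    case (eng h k)
    have "h \<in> carrier ?G" "k \<in> carrier ?G"
      using eng.hyps G.generate_in_carrier[OF R] by blast+
    then show ?case using eng.IH mult cl by simp
  qed
  then show ?thesis using c(2) by blast
qed

lemma (in comm_group) finprod_int_pow_increment:
  assumes S: "finite S" and t: "t \<in> S \<rightarrow> carrier G" and j: "j \<in> S"
  shows "finprod G (\<lambda>k. t k [^] ((v(j := v j + 1)) k :: int)) S
       = t j \<otimes> finprod G (\<lambda>k. t k [^] (v k :: int)) S"
proof -
  let ?F = "\<lambda>v :: _ \<Rightarrow> int. finprod G (\<lambda>k. t k [^] v k)"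
  have split: "?F u S = t j [^] u j \<otimes> ?F u (S - {j})" for u
    using finprod_insert[of "S - {j}" j "\<lambda>k. t k [^] u k"] S t j
    by (auto simp: insert_absorb Pi_iff)
  have rest: "?F (v(j := v j + 1)) (S - {j}) = ?F v (S - {j})"
    using t by (intro finprod_cong') (auto simp: Pi_iff)
  have tj: "t j \<in> carrier G" using t j by auto
  have "t j [^] (v j + 1) = t j \<otimes> t j [^] v j"
    using tj int_pow_mult[of "t j" 1 "v j"] by (simp add: add.commute int_pow_1)
  moreover have "?F v (S - {j}) \<in> carrier G" using t by (intro finprod_closed) (auto simp: Pi_iff)
  ultimately show ?thesis
    using split[of "v(j := v j + 1)"] split[of v] rest tj by (simp add: m_assoc)
qed

text \<open>
  The action of the vector \<open>v\<close> on \<open>X\<close>: the product over \<open>k \<in> S\<close> of the \<open>v k\<close>-th powers of the right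
  translations by \<open>k\<close>, well defined because \<open>Inn X\<close> is commutative.
\<close>

definition translate :: "'a quandle \<Rightarrow> 'a set \<Rightarrow> ('a \<Rightarrow> int) \<Rightarrow> 'a \<Rightarrow> 'a" where
  "translate X S v = finprod (Inn X) (\<lambda>k. right_translation X k [^]\<^bsub>Inn X\<^esub> v k) S"

text \<open>
  This normal form map sends \<open>(i, v)\<close> to the generator \<open>i\<close> moved by \<open>v\<close>.  Acting from the right
  by \<open>translate X S w j\<close> is the same as acting by \<open>j\<close>, which adds one to the \<open>j\<close>-th exponent.
  For \<open>j = i\<close> the model leaves \<open>v\<close> unchanged, and so does \<open>X\<close>: the extra translation can be applied
  to \<open>i\<close> first, where it is idle.
\<close>

lemma translate_hom:
  assumes X: "abelian_quandle X" and S: "finite S" "S \<subseteq> carrier X"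
  shows "(\<lambda>(i, v). translate X S v i) \<in> quandle_hom (coord_quandle S 0) X"
proof -
  interpret quandle X using X by (simp add: abelian_quandle_def)
  interpret I: comm_group "Inn X" using X by (simp add: abelian_quandle_def)
  have t: "right_translation X \<in> S \<rightarrow> carrier (Inn X)"
    using right_translation_in_Inn[OF quandle_axioms] S(2) by blast
  have E: "translate X S v \<in> carrier (Inn X)" for v
    unfolding translate_def using t by (intro I.finprod_closed) (auto simp: Pi_iff)
  have step: "translate X S (v(j := v j + 1)) u = translate X S v u \<star>\<^bsub>X\<^esub> j"
      "translate X S (v(j := v j + 1)) u = translate X S v (u \<star>\<^bsub>X\<^esub> j)"
    if "j \<in> S" "u \<in> carrier X" for v j u
  proof -
    have tj: "right_translation X j \<in> carrier (Inn X)" using t that by blast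
    have eq: "translate X S (v(j := v j + 1)) = right_translation X j \<otimes>\<^bsub>Inn X\<^esub> translate X S v"
      unfolding translate_def by (rule I.finprod_int_pow_increment[OF S(1) t that(1)])
    show "translate X S (v(j := v j + 1)) u = translate X S v u \<star>\<^bsub>X\<^esub> j"
      using Inn_mult_apply[OF tj E that(2)] Inn_apply_closed[OF E that(2)]
      by (simp add: eq right_translation_def)
    show "translate X S (v(j := v j + 1)) u = translate X S v (u \<star>\<^bsub>X\<^esub> j)"
      using Inn_mult_apply[OF E tj that(2)] I.m_comm[OF tj E, of v] that(2) eq
      by (simp add: right_translation_def)
  qed
  have hom: "translate X S (bump 0 i j 1 v) i = translate X S v i \<star>\<^bsub>X\<^esub> translate X S w j"
    if "i \<in> S" "j \<in> S" for i j v w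
  proof -
    have c: "i \<in> carrier X" "j \<in> carrier X" using that S by auto
    have "translate X S v i \<star>\<^bsub>X\<^esub> translate X S w j = translate X S v i \<star>\<^bsub>X\<^esub> j"
      using abelian_quandle_op_Inn[OF X E Inn_apply_closed[OF E c(1)] c(2)] .
    moreover have "translate X S v i \<star>\<^bsub>X\<^esub> i = translate X S v i"
      using step(1)[OF that(1) c(1), of v] step(2)[OF that(1) c(1), of v] idem[OF c(1)] by simp
    ultimately show ?thesis
      using step(1)[OF that(2) c(1), of v] by (auto simp: bump_def)
  qed
  show ?thesis unfolding quandle_hom_def
  proof (intro CollectI conjI ballI Pi_I)
    fix x y assume x: "x \<in> carrier (coord_quandle S 0)" and y: "y \<in> carrier (coord_quandle S 0)"
    obtain i v j w where [simp]: "x = (i, v)" "y = (j, w)" by fastforce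
    have "i \<in> S" "j \<in> S" using x y by (simp_all add: coord_carrier)
    then show "(case x \<star>\<^bsub>coord_quandle S 0\<^esub> y of (i, v) \<Rightarrow> translate X S v i) =
        (case x of (i, v) \<Rightarrow> translate X S v i) \<star>\<^bsub>X\<^esub> (case y of (i, v) \<Rightarrow> translate X S v i)"
      using hom by (simp add: coord_op)
    show "(case x of (i, v) \<Rightarrow> translate X S v i) \<in> carrier X"
      using Inn_apply_closed[OF E] \<open>i \<in> S\<close> S(2) by auto
  qed
qed

lemma quandle_hom_closed:
  "\<lbrakk>h \<in> quandle_hom X Y; x \<in> carrier X\<rbrakk> \<Longrightarrow> h x \<in> carrier Y"
  by (auto simp: quandle_hom_def)

lemma quandle_hom_op:
  "\<lbrakk>h \<in> quandle_hom X Y; x \<in> carrier X; y \<in> carrier X\<rbrakk> \<Longrightarrow> h (x \<star>\<^bsub>X\<^esub> y) = h x \<star>\<^bsub>Y\<^esub> h y"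
  by (simp add: quandle_hom_def)

lemma quandle_hom_comp:
  assumes f: "f \<in> quandle_hom X Y" and g: "g \<in> quandle_hom Y Z"
  shows "g \<circ> f \<in> quandle_hom X Z"
  using quandle_hom_closed[OF f] quandle_hom_op[OF f] quandle_hom_closed[OF g] quandle_hom_op[OF g]
  by (simp add: quandle_hom_def)

lemma free_abelian_quandle_hom_eqI:
  assumes free: "free_abelian_quandle_on X S" and S: "countable S" and Y: "abelian_quandle Y"
    and f: "f \<in> quandle_hom X Y" and g: "g \<in> quandle_hom X Y"
    and eq: "\<And>s. s \<in> S \<Longrightarrow> f s = g s" and x: "x \<in> carrier X"
  shows "f x = g x"
proof -
  have X: "quandle X" "S \<subseteq> carrier X"
    using free by (auto simp: free_abelian_quandle_on_def abelian_quandle_def)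
  have hom: "restrict k (carrier X) \<in> quandle_hom X Y" if "k \<in> quandle_hom X Y" for k
    using that quandle.closed[OF X(1)] by (auto simp: quandle_hom_def)
  have ext: "restrict k (carrier X) \<in> quandle_hom X Y \<and> restrict k (carrier X) \<in> extensional (carrier X)
      \<and> (\<forall>s\<in>S. restrict k (carrier X) s = f s)"
    if "k \<in> quandle_hom X Y" "\<forall>s\<in>S. k s = f s" for k
    using hom[OF that(1)] that(2) X(2) by (simp add: subset_iff)
  have "f \<in> S \<rightarrow> carrier Y" using quandle_hom_closed[OF f] X(2) by blast
  note uniq = the1_equality[OF free_abelian_quandle_universal[OF free S Y this]]
  have "restrict f (carrier X) = restrict g (carrier X)"
    by (rule trans[OF uniq[OF ext, OF f, symmetric] uniq[OF ext, OF g]]) (simp_all add: eq)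
  then show ?thesis using x by (metis restrict_apply')
qed

text \<open>
  The normal form map after \<open>h\<close> is an endomorphism of \<open>X\<close> fixing the free generators, hence the
  identity.
\<close>

lemma free_abelian_quandle_coordinates:
  assumes free: "free_abelian_quandle_on X S" and S: "finite S"
  obtains h where "h \<in> quandle_hom X (coord_quandle S 0)" "inj_on h (carrier X)"
proof -
  let ?Q = "coord_quandle S 0"
  have X: "abelian_quandle X" "S \<subseteq> carrier X"
    using free by (auto simp: free_abelian_quandle_on_def)
  interpret quandle X using X by (simp add: abelian_quandle_def)
  interpret I: comm_group "Inn X" using X by (simp add: abelian_quandle_def)
  have "(\<lambda>s. (s, \<lambda>_. 0)) \<in> S \<rightarrow> carrier ?Q" by (simp add: coord_carrier)
  from free_abelian_quandle_universal[OF free countable_finite[OF S] abelian_coord_quandle this]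
  obtain h where h: "h \<in> quandle_hom X ?Q" "\<forall>s\<in>S. h s = (s, \<lambda>_. 0)" by blast
  let ?g = "\<lambda>(i, v). translate X S v i"
  have gh: "?g \<circ> h \<in> quandle_hom X X"
    using quandle_hom_comp[OF h(1) translate_hom[OF X(1) S X(2)]] .
  have zero: "translate X S (\<lambda>_. 0) s = s" if "s \<in> S" for s
    using that X(2) by (auto simp: translate_def Inn_one_apply)
  have "id \<in> quandle_hom X X" by (simp add: quandle_hom_def)
  from free_abelian_quandle_hom_eqI[OF free countable_finite[OF S] X(1) gh this]
  have "?g (h x) = x" if "x \<in> carrier X" for x
    using that h(2) zero by (simp add: o_def)
  then have "inj_on h (carrier X)" by (rule inj_on_inverseI)
  then show ?thesis using h(1) that by blast
qed


section \<open>Separation\<close>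

lemma subquandle_vimage:
  assumes X: "quandle X" and Y: "quandle Y" and h: "h \<in> quandle_hom X Y" and C: "subquandle C Y"
  shows "subquandle {x \<in> carrier X. h x \<in> C} X"
  unfolding subquandle_def
proof (intro conjI ballI)
  fix x y assume "x \<in> {x \<in> carrier X. h x \<in> C}" "y \<in> {x \<in> carrier X. h x \<in> C}"
  then have xy: "x \<in> carrier X" "y \<in> carrier X" "h x \<in> C" "h y \<in> C" by auto
  show "x \<star>\<^bsub>X\<^esub> y \<in> {x \<in> carrier X. h x \<in> C}"
    using quandle.closed[OF X xy(1,2)] quandle_hom_op[OF h xy(1,2)] C xy(3,4)
    by (simp add: subquandle_def)
  show "qinv X x y \<in> {x \<in> carrier X. h x \<in> C}"
    using quandle.qinv_props(1)[OF X xy(1,2)] quandle_hom_qinv[OF X Y h xy(1,2)] C xy(3,4)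
    by (simp add: subquandle_def)
qed auto

lemma subquandle_image:
  assumes X: "quandle X" and Y: "quandle Y" and h: "h \<in> quandle_hom X Y" and T: "subquandle T X"
  shows "subquandle (h ` T) Y"
  unfolding subquandle_def
proof (intro conjI ballI)
  have TX: "T \<subseteq> carrier X" using T by (simp add: subquandle_def)
  then show "h ` T \<subseteq> carrier Y" using quandle_hom_closed[OF h] by blast
  fix a b assume "a \<in> h ` T" "b \<in> h ` T"
  then obtain x y where xy: "x \<in> T" "y \<in> T" and [simp]: "a = h x" "b = h y" by blast
  then have c: "x \<in> carrier X" "y \<in> carrier X" using TX by auto
  have "x \<star>\<^bsub>X\<^esub> y \<in> T" "qinv X x y \<in> T" using T xy by (auto simp: subquandle_def)
  then show "a \<star>\<^bsub>Y\<^esub> b \<in> h ` T" "qinv Y a b \<in> h ` T"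
    by (simp_all flip: quandle_hom_op[OF h c] quandle_hom_qinv[OF X Y h c])
qed

text \<open>Separability asks for finite quandles of natural numbers, so the finite models are copied there.\<close>

lemma finite_quandle_to_nat:
  fixes F :: "'b quandle"
  assumes F: "abelian_quandle F" "finite (carrier F)"
  obtains F' :: "nat quandle" and g
  where "quandle F'" "finite (carrier F')" "g \<in> quandle_hom F F'" "inj_on g (carrier F)"
proof -
  interpret quandle F using F by (simp add: abelian_quandle_def)
  have sub: "subquandle (carrier F) F" using closed qinv_props by (auto simp: subquandle_def)
  let ?g = "to_nat_on (carrier F)"
  let ?F = "\<lparr>carrier = ?g ` carrier F, qop = \<lambda>a b. ?g (inv_into (carrier F) ?g a \<star>\<^bsub>F\<^esub>
     inv_into (carrier F) ?g b)\<rparr>"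
  have inj: "inj_on ?g (carrier F)" using F(2) by (intro inj_on_to_nat_on countable_finite)
  show ?thesis
  proof
    show "quandle ?F" using abelian_quandle_image(1)[OF F(1) sub inj] by (simp add: abelian_quandle_def)
    show "finite (carrier ?F)" using F(2) by simp
    show "?g \<in> quandle_hom F ?F"
      using abelian_quandle_image(2)[OF F(1) sub inj] by (simp add: quandle_hom_def)
  qed (rule inj)
qed

theorem theorem5p10:
  fixes X :: "'a quandle" and S :: "'a set"
  assumes "finite S"
    and "free_abelian_quandle_on X S"
  shows "subquandle_separable X"
  unfolding subquandle_separable_def separable_in_def
proof (intro conjI allI impI ballI)
  show X: "quandle X"
    using assms(2) by (simp add: free_abelian_quandle_on_def abelian_quandle_def)
  fix T x assume T: "fin_gen_subquandle T X" and x: "x \<in> carrier X - T"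
  let ?Q = "coord_quandle S"
  obtain h where h: "h \<in> quandle_hom X (?Q 0)" and inj: "inj_on h (carrier X)"
    using free_abelian_quandle_coordinates[OF assms(2,1)] .
  have sub: "subquandle T X" using T by (simp add: fin_gen_subquandle_def)
  obtain A where A: "finite A" "A \<subseteq> T"
    and least: "\<forall>T'. subquandle T' X \<and> A \<subseteq> T' \<longrightarrow> T \<subseteq> T'"
    using T unfolding fin_gen_subquandle_def by (elim conjE exE)
  have TX: "T \<subseteq> carrier X" using sub by (simp add: subquandle_def)
  have hX: "h y \<in> carrier (?Q 0)" if "y \<in> carrier X" for y
    using quandle_hom_closed[OF h that] .
  define J where "J = fst ` h ` A"
  \<comment> \<open>\<open>TC\<close> and \<open>CT\<close> below say that the image of \<open>T\<close> in the model is exactly this set.\<close>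
  define C where "C = {(i, w). (i, w) \<in> carrier (?Q 0) \<and>
    (\<exists>a. (i, a) \<in> h ` A \<and> (\<forall>k. k \<notin> J \<longrightarrow> w k = a k))}"
  have "subquandle C (?Q 0)"
    unfolding C_def J_def using A TX hX by (intro subquandle_coord_hull) blast
  then have "subquandle {y \<in> carrier X. h y \<in> C} X"
    by (rule subquandle_vimage[OF X quandle_coord_quandle h])
  moreover have "A \<subseteq> {y \<in> carrier X. h y \<in> C}"
  proof
    fix a assume a: "a \<in> A"
    obtain i v where iv: "h a = (i, v)" by fastforce
    have "(i, v) \<in> h ` A" using a iv by (metis imageI)
    moreover have "(i, v) \<in> carrier (?Q 0)" using hX[of a] a A TX iv by auto
    ultimately have "h a \<in> C" unfolding iv C_def by blast
    then show "a \<in> {y \<in> carrier X. h y \<in> C}" using a A TX by blast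
  qed
  ultimately have least_sub: "T \<subseteq> {y \<in> carrier X. h y \<in> C}"
    by (intro least[rule_format, OF conjI])
  have TC: "h y \<in> C" if "y \<in> T" for y
    using subsetD[OF least_sub that] by simp
  have CT: "(i, v) \<in> h ` T"
    if "(i, v) \<in> carrier (?Q 0)" "(i, a) \<in> h ` A" "\<forall>k. k \<notin> J \<longrightarrow> v k = a k" for i v a
  proof (rule subquandle_coord_fill)
    show "subquandle (h ` T) (?Q 0)"
      by (rule subquandle_image[OF X quandle_coord_quandle h sub])
    show "(i, a) \<in> h ` T" "finite J" "J \<subseteq> fst ` h ` T" using that A by (auto simp: J_def)
    then have "(i, a) \<in> carrier (?Q 0)" using hX TX by (metis imageE subsetD)
    then show "v i = a i" using that(1) by (simp add: coord_carrier)
  qed (use that in auto)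
  obtain i v where iv: "h x = (i, v)" by fastforce
  \<comment> \<open>The modulus must exceed every difference between a coordinate of \<open>h x\<close> and the same coordinate
      of the image of a generator of \<open>T\<close>, so that a congruence of such coordinates is an equality;
      the inserted \<open>0\<close> makes it positive even if there are none.\<close>
  define D where "D = (\<lambda>(a, k). \<bar>v k - snd (h a) k\<bar>) ` (A \<times> S)"
  define m where "m = Max (insert 0 D) + 1"
  have "finite D" using A assms(1) by (simp add: D_def)
  then have m: "d < m" if "d \<in> insert 0 D" for d
    using Max_ge[of "insert 0 D" d] that by (simp add: m_def)
  let ?red = "\<lambda>(i :: 'a, v :: 'a \<Rightarrow> int). (i, \<lambda>k. v k mod m)"
  have sep: "?red (h x) \<noteq> ?red (h y)" if y: "y \<in> T" for y
  proof
    assume eq: "?red (h x) = ?red (h y)"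
    obtain w where w: "h y = (i, w)" "\<And>k. v k mod m = w k mod m"
      using eq iv by (cases "h y") (auto simp: fun_eq_iff)
    obtain a where a: "(i, a) \<in> h ` A" "\<forall>k. k \<notin> J \<longrightarrow> w k = a k" using TC[OF y] w by (auto simp: C_def)
    obtain b where b: "b \<in> A" "h b = (i, a)" using a(1) by (metis imageE)
    have "v k = a k" if k: "k \<notin> J" for k
    proof (cases "k \<in> S")
      case True
      then have "\<bar>v k - a k\<bar> \<in> D" using b unfolding D_def by force
      then have "\<bar>v k - a k\<bar> < m" using m by blast
      moreover have "m dvd v k - a k" using w(2)[of k] a(2) k by (simp add: mod_eq_dvd_iff)
      ultimately show ?thesis using zdvd_imp_le[of m "\<bar>v k - a k\<bar>"] by fastforce
    next
      case False
      then show ?thesis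
        using hX[of x] hX[of b] iv b x A TX by (auto simp: coord_carrier)
    qed
    then have "h x \<in> h ` T" using CT[of i v a] a iv hX[of x] x by auto
    then show False using inj x TX by (auto simp: inj_on_def)
  qed
  have "0 < m" using m by blast
  from finite_quandle_to_nat[OF abelian_coord_quandle finite_coord_quandle[OF assms(1) this]]
  obtain F :: "nat quandle" and g where F: "quandle F" "finite (carrier F)"
    "g \<in> quandle_hom (?Q m) F" "inj_on g (carrier (?Q m))" by blast
  have red: "?red \<circ> h \<in> quandle_hom X (?Q m)"
    by (rule quandle_hom_comp[OF h reduction_hom])
  have "g ((?red \<circ> h) x) \<noteq> g ((?red \<circ> h) y)" if y: "y \<in> T" for y
  proof -
    have "(?red \<circ> h) x \<in> carrier (?Q m)" "(?red \<circ> h) y \<in> carrier (?Q m)"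
      using quandle_hom_closed[OF red] x y TX by blast+
    then show ?thesis using sep[OF y] F(4) by (metis comp_apply inj_onD)
  qed
  then have "(g \<circ> (?red \<circ> h)) x \<notin> (g \<circ> (?red \<circ> h)) ` T" by auto
  then show "\<exists>(F :: nat quandle) \<phi>.
     quandle F \<and> finite (carrier F) \<and> \<phi> \<in> quandle_hom X F \<and> \<phi> x \<notin> \<phi> ` T"
    using F(1,2) quandle_hom_comp[OF red F(3)] by blast
qed

end
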